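(* Let $p\ge 1$, $a>0$, let $\mathbf{\Sigma}:\mathbf{x}\mapsto\mathbf{\Sigma}_{\mathbf{x}}$ be a mapping from $\mathbb{R}^p$ to the set of real symmetric positive definite $p\times p$ matrices, and let $\nu:\mathbb{R}^p\to(0,+\infty)$. Let $g(\mathbf{x};t)=c\,t^{\nu(\mathbf{x})}$ for $\mathbf{x}\in\mathbb{R}^p$, $t>0$, with $c\neq0$ a constant, and let $M(dt)=2t^{p-1}h(t^2)\mathbf{1}_{[0,+\infty)}(t)\,dt$, where $h$ is the density of the Gamma distribution $\mathcal{G}a(1,1/4a^2)$. Consider $$C^{NS}(\mathbf{x},\mathbf{y})=\pi^{-\frac p2}\left|\frac{\mathbf{\Sigma}_{\mathbf{x}}+\mathbf{\Sigma}_{\mathbf{y}}}{2}\right|^{-\frac12}\int_0^{+\infty}g(\mathbf{x};t)g(\mathbf{y};t)\,t^{-p}\exp\left(-\frac{Q_{\mathbf{x}\mathbf{y}}(\mathbf{x}-\mathbf{y})}{t^2}\right)M(dt).$$ Then the associated correlation function $R^{NS}(\mathbf{x},\mathbf{y})=C^{NS}(\mathbf{x},\mathbf{y})/\sqrt{C^{NS}(\mathbf{x},\mathbf{x})\,C^{NS}(\mathbf{y},\mathbf{y})}$ satisfies, for all $\mathbf{x},\mathbf{y}\in\mathbb{R}^p$, $$R^{NS}(\mathbf{x},\mathbf{y})=\phi_{\mathbf{x}\mathbf{y}}\,\frac{2^{1-\nu(\mathbf{x},\mathbf{y})}}{\sqrt{\Gamma(\nu(\mathbf{x}))\Gamma(\nu(\mathbf{y}))}}\,M_{\nu(\mathbf{x},\mathbf{y})}\left(\sqrt{Q_{\mathbf{x}\mathbf{y}}(\mathbf{x}-\mathbf{y})}\right),$$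 where $\nu(\mathbf{x},\mathbf{y})=(\nu(\mathbf{x})+\nu(\mathbf{y}))/2$ and $M_{\nu(\mathbf{x},\mathbf{y})}(\tau)=(\tau/a)^{\nu(\mathbf{x},\mathbf{y})}K_{\nu(\mathbf{x},\mathbf{y})}(\tau/a)$ for $\tau\ge0$.
   Context: Here $|A|$ denotes the determinant of a matrix $A$; for $\mathbf{h}\in\mathbb{R}^p$, $Q_{\mathbf{x}\mathbf{y}}(\mathbf{h})=\mathbf{h}^T\left(\frac{\mathbf{\Sigma}_{\mathbf{x}}+\mathbf{\Sigma}_{\mathbf{y}}}{2}\right)^{-1}\mathbf{h}$; and $\phi_{\mathbf{x}\mathbf{y}}=|\mathbf{\Sigma}_{\mathbf{x}}|^{\frac14}|\mathbf{\Sigma}_{\mathbf{y}}|^{\frac14}\left|\frac{\mathbf{\Sigma}_{\mathbf{x}}+\mathbf{\Sigma}_{\mathbf{y}}}{2}\right|^{-\frac12}$. $\mathcal{G}a(\alpha,\beta)$ is the Gamma distribution with shape $\alpha$ and rate $\beta$, so $h(s)=\frac{1}{4a^2}e^{-s/(4a^2)}$ for $s>0$. $K_\nu$ is the modified Bessel function of the second kind of order $\nu$, e.g. $K_\nu(z)=\frac12\left(\frac z2\right)^{\nu}\int_0^\infty w^{-\nu-1}\exp\left(-w-\frac{z^2}{4w}\right)dw$ for $z>0$. The function $z\mapsto z^\nu K_\nu(z)$ ($\nu>0$) is extended to $z=0$ by its limit $2^{\nu-1}\Gamma(\nu)$. *)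

theory Defs
  imports "HOL-Analysis.Analysis"
begin

definition sym_pos_def :: "real ^ 'n ^ 'n \<Rightarrow> bool" where
  "sym_pos_def A \<longleftrightarrow> transpose A = A \<and> (\<forall>h. h \<noteq> 0 \<longrightarrow> h \<bullet> (A *v h) > 0)"

definition Sigma_avg :: "(real ^ 'n \<Rightarrow> real ^ 'n ^ 'n) \<Rightarrow> real ^ 'n \<Rightarrow> real ^ 'n \<Rightarrow> real ^ 'n ^ 'n" where
  "Sigma_avg \<Sigma> x y = (1 / 2) *\<^sub>R (\<Sigma> x + \<Sigma> y)"

definition Q_form :: "(real ^ 'n \<Rightarrow> real ^ 'n ^ 'n) \<Rightarrow> real ^ 'n \<Rightarrow> real ^ 'n \<Rightarrow> real ^ 'n \<Rightarrow> real" where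
  "Q_form \<Sigma> x y h = h \<bullet> (matrix_inv (Sigma_avg \<Sigma> x y) *v h)"

definition phi :: "(real ^ 'n \<Rightarrow> real ^ 'n ^ 'n) \<Rightarrow> real ^ 'n \<Rightarrow> real ^ 'n \<Rightarrow> real" where
  "phi \<Sigma> x y = det (\<Sigma> x) powr (1 / 4) * det (\<Sigma> y) powr (1 / 4)
     * det (Sigma_avg \<Sigma> x y) powr (- 1 / 2)"

text \<open>Shape \<open>\<alpha>\<close>, rate \<open>\<beta>\<close>.\<close>
definition gamma_density :: "real \<Rightarrow> real \<Rightarrow> real \<Rightarrow> real" where
  "gamma_density \<alpha> \<beta> s =
     (if s > 0 then \<beta> powr \<alpha> / Gamma \<alpha> * s powr (\<alpha> - 1) * exp (- \<beta> * s) else 0)"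

text \<open>Modified Bessel function of the second kind of order \<open>\<nu>\<close>, by its integral
  representation, which is valid for \<open>z > 0\<close>; only such arguments are meaningful.\<close>
definition Bessel_K :: "real \<Rightarrow> real \<Rightarrow> real" where
  "Bessel_K \<nu> z = 1 / 2 * (z / 2) powr \<nu> *
     (LBINT w:{0<..}. w powr (- \<nu> - 1) * exp (- w - z\<^sup>2 / (4 * w)))"

text \<open>The map \<open>z \<mapsto> z\<^sup>\<nu> K\<^sub>\<nu>(z)\<close> for \<open>\<nu> > 0\<close> and \<open>z \<ge> 0\<close>; its value at 0 is the limit at 0
  from the right.\<close>
definition pow_Bessel_K :: "real \<Rightarrow> real \<Rightarrow> real" where
  "pow_Bessel_K \<nu> z =
     (if z = 0 then 2 powr (\<nu> - 1) * Gamma \<nu> else z powr \<nu> * Bessel_K \<nu> z)"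

definition Matern_M :: "real \<Rightarrow> real \<Rightarrow> real \<Rightarrow> real" where
  "Matern_M a \<nu> \<tau> = pow_Bessel_K \<nu> (\<tau> / a)"

definition C_NS ::
  "(real ^ 'n \<Rightarrow> real ^ 'n ^ 'n) \<Rightarrow> (real ^ 'n \<Rightarrow> real \<Rightarrow> real) \<Rightarrow> real measure
    \<Rightarrow> real ^ 'n \<Rightarrow> real ^ 'n \<Rightarrow> real" where
  "C_NS \<Sigma> g M x y =
     pi powr (- real CARD('n) / 2) * det (Sigma_avg \<Sigma> x y) powr (- 1 / 2) *
     (LINT t:{0<..}|M. g x t * g y t * t powr (- real CARD('n))
        * exp (- Q_form \<Sigma> x y (x - y) / t\<^sup>2))"

definition correlation :: "('a \<Rightarrow> 'a \<Rightarrow> real) \<Rightarrow> 'a \<Rightarrow> 'a \<Rightarrow> real" where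
  "correlation C x y = C x y / sqrt (C x x * C y y)"

end

theory Submission
  imports Defs
begin

text \<open>
  With \<open>I \<nu> b = \<integral>\<^sub>0\<^sup>\<infinity> w\<^sup>\<nu>\<^sup>-\<^sup>1 exp (- w - b / w) dw\<close>, the substitution \<open>w = t\<^sup>2 / (4 a\<^sup>2)\<close> turns
  the covariance integral into a multiple of \<open>I \<nu> b\<close> at \<open>b = Q / (4 a\<^sup>2)\<close>, and the inversion
  \<open>w \<mapsto> b / w\<close> gives \<open>I \<nu> (z\<^sup>2 / 4) = 2\<^sup>1\<^sup>-\<^sup>\<nu> z\<^sup>\<nu> K\<^sub>\<nu>(z)\<close>. On the diagonal \<open>b = 0\<close> and \<open>I\<close> is the
  Gamma function, so the powers of \<open>4 a\<^sup>2\<close> cancel in the correlation.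
\<close>

section \<open>Bessel-type integrals and substitution\<close>

definition bessel_integral :: "real \<Rightarrow> real \<Rightarrow> real" where
  "bessel_integral \<nu> b = (LBINT w:{0<..}. w powr (\<nu> - 1) * exp (- w - b / w))"

text \<open>Absolute integrability transfers in both directions under the substitution, so the two
  sides are either both genuine integrals or both the default value 0.\<close>

lemma set_lebesgue_integral_change_of_variables:
  fixes f \<phi> \<phi>' :: "real \<Rightarrow> real"
  assumes [measurable]: "S \<in> sets borel" "T \<in> sets borel"
    and [measurable]: "f \<in> borel_measurable borel" "(\<lambda>t. \<bar>\<phi>' t\<bar> * f (\<phi> t)) \<in> borel_measurable borel"
    and der: "\<And>t. t \<in> S \<Longrightarrow> (\<phi> has_field_derivative \<phi>' t) (at t)"
    and bij: "bij_betw \<phi> S T"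
  shows "(LBINT t:S. \<bar>\<phi>' t\<bar> * f (\<phi> t)) = (LBINT w:T. f w)"
proof -
  have T: "\<phi> ` S = T" and inj: "inj_on \<phi> S"
    using bij by (auto simp: bij_betw_def)
  have S: "S \<in> sets lebesgue"
    using assms(1) by simp
  note cov = has_absolute_integral_change_of_variables_1'[OF S
      has_field_derivative_at_within[OF der] inj, of f, unfolded T]
  have "(LINT t:S|lebesgue. \<bar>\<phi>' t\<bar> * f (\<phi> t)) = (LINT w:T|lebesgue. f w)"
  proof (cases "f absolutely_integrable_on T")
    case True
    with cov[of "integral T f"] show ?thesis
      by (simp add: set_lebesgue_integral_eq_integral)
  next
    case False
    with cov have "\<not> (\<lambda>t. \<bar>\<phi>' t\<bar> * f (\<phi> t)) absolutely_integrable_on S"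
      by blast
    with False show ?thesis
      by (simp add: set_lebesgue_integral_def set_integrable_def not_integrable_integral_eq)
  qed
  \<comment> \<open>Borel measurability of both integrands allows passing from the completed measure
    \<open>lebesgue\<close> to \<open>lborel\<close>.\<close>
  then show ?thesis
    unfolding set_lebesgue_integral_def by (simp add: integral_completion)
qed

lemma bessel_integral_0:
  assumes "\<nu> > 0"
  shows "bessel_integral \<nu> 0 = Gamma \<nu>"
proof -
  \<comment> \<open>The domains differ only at 0, where \<open>0 powr (\<nu> - 1)\<close> is 0, so
    the integrands agree pointwise with Euler's integrand.\<close>
  have "bessel_integral \<nu> 0 = (LBINT t. indicator {0..} t * t powr (\<nu> - 1) / exp t)"
    unfolding bessel_integral_def set_lebesgue_integral_def
    by (intro Bochner_Integration.integral_cong) (auto simp: indicator_def exp_minus field_simps)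
  also have "\<dots> = enn2real (\<integral>\<^sup>+t. ennreal (indicator {0..} t * t powr (\<nu> - 1) / exp t) \<partial>lborel)"
    by (intro integral_eq_nn_integral) auto
  also have "\<dots> = Gamma \<nu>"
    using assms by (simp flip: Gamma_conv_nn_integral_real add: Gamma_real_pos less_imp_le)
  finally show ?thesis .
qed

text \<open>The involution \<open>u \<mapsto> b / u\<close> of the half-line swaps the two terms of
  the exponent; only the power and the Jacobian change. In terms of Bessel functions this is the
  symmetry of K in the sign of its order.\<close>

lemma bessel_integral_reflect:
  assumes "b > 0"
  shows "bessel_integral (- \<nu>) b = b powr (- \<nu>) * bessel_integral \<nu> b"
proof -
  let ?f = "\<lambda>w. w powr (- \<nu> - 1) * exp (- w - b / w)"
  have "bessel_integral (- \<nu>) b = (LBINT u:{0<..}. \<bar>- b / u\<^sup>2\<bar> * ?f (b / u))"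
    unfolding bessel_integral_def
  proof (rule set_lebesgue_integral_change_of_variables[symmetric])
    show "bij_betw (\<lambda>u. b / u) {0<..} {0<..}"
      using assms by (intro bij_betwI[where g = "\<lambda>u. b / u"]) auto
    show "((\<lambda>u. b / u) has_field_derivative - b / u\<^sup>2) (at u)" if "u \<in> {0<..}" for u
      using that by (auto intro!: derivative_eq_intros simp: power2_eq_square)
  qed auto
  also have "\<dots> = (LBINT u:{0<..}. b powr (- \<nu>) * (u powr (\<nu> - 1) * exp (- u - b / u)))"
  proof (intro set_lebesgue_integral_cong ballI allI impI)
    fix u :: real assume "u \<in> {0<..}"
    then have u: "u > 0" by simp
    have "\<bar>- b / u\<^sup>2\<bar> * (b / u) powr (- \<nu> - 1) = b powr (- \<nu>) * u powr (\<nu> - 1)"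
      using assms u
      by (simp add: powr_divide powr_diff powr_minus field_simps power2_eq_square)
    moreover have "- (b / u) - b / (b / u) = - u - b / u"
      using assms u by (simp add: field_simps)
    ultimately show "\<bar>- b / u\<^sup>2\<bar> * ?f (b / u) = b powr (- \<nu>) * (u powr (\<nu> - 1) * exp (- u - b / u))"
      by (metis mult.assoc)
  qed auto
  finally show ?thesis
    by (simp add: bessel_integral_def)
qed

lemma bessel_integral_eq_pow_Bessel_K:
  assumes "\<nu> > 0" "z \<ge> 0"
  shows "bessel_integral \<nu> (z\<^sup>2 / 4) = 2 powr (1 - \<nu>) * pow_Bessel_K \<nu> z"
proof (cases "z = 0")
  case True
  then show ?thesis
    using assms by (simp add: pow_Bessel_K_def bessel_integral_0 flip: powr_add mult.assoc)
next
  case False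
  with assms have z: "z > 0" by simp
  \<comment> \<open>The integral in \<open>Bessel_K\<close> has the power
    \<open>- \<nu> - 1\<close>, hence order \<open>- \<nu>\<close>; reflection at
    \<open>b = z\<^sup>2 / 4\<close> brings it to order \<open>\<nu>\<close>.\<close>
  have K: "Bessel_K \<nu> z = 1 / 2 * (z / 2) powr \<nu> * bessel_integral (- \<nu>) (z\<^sup>2 / 4)"
    by (simp add: Bessel_K_def bessel_integral_def)
  \<comment> \<open>One of the two factors cancels the prefactor \<open>(z / 2) powr \<nu>\<close>
    of \<open>Bessel_K\<close>.\<close>
  have "(z\<^sup>2 / 4) powr (- \<nu>) = (z / 2) powr (- \<nu>) * (z / 2) powr (- \<nu>)"
    using z by (simp add: power2_eq_square flip: powr_mult)
  then have "pow_Bessel_K \<nu> z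
      = z powr \<nu> * (1 / 2 * (z / 2) powr (- \<nu>) * bessel_integral \<nu> (z\<^sup>2 / 4))"
    using z by (simp add: pow_Bessel_K_def K bessel_integral_reflect powr_minus)
  also have "\<dots> = 2 powr (\<nu> - 1) * bessel_integral \<nu> (z\<^sup>2 / 4)"
    using z by (simp add: powr_divide powr_diff powr_minus field_simps)
  finally show ?thesis
    by (simp flip: powr_add mult.assoc)
qed

section \<open>The covariance as a Gamma mixture\<close>

text \<open>Substituting \<open>w = t\<^sup>2 / (4 * a\<^sup>2)\<close> turns the Gamma density into
  a multiple of \<open>exp (- w)\<close>. The rate in the density matches the denominator of the
  Jacobian, and the dimension \<open>p\<close> cancels up to a factor \<open>1 / t\<close>, so only
  the power \<open>\<nu> - 1\<close> of \<open>4 * a\<^sup>2\<close> survives.\<close>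

lemma gamma_mixture_integral:
  fixes a \<nu> q :: real and p :: nat
  assumes a: "a > 0" and p: "p \<ge> 1"
  shows "(LBINT t:{0<..}. 2 * t ^ (p - 1) * gamma_density 1 (1 / (4 * a\<^sup>2)) (t\<^sup>2)
            * (t powr (2 * \<nu>) * t powr (- real p) * exp (- q / t\<^sup>2)))
         = (4 * a\<^sup>2) powr (\<nu> - 1) * bessel_integral \<nu> (q / (4 * a\<^sup>2))"
proof -
  let ?k = "4 * a\<^sup>2"
  let ?f = "\<lambda>w. w powr (\<nu> - 1) * exp (- w - q / ?k / w)"
  have k: "?k > 0" using a by simp
  have "bessel_integral \<nu> (q / ?k) = (LBINT t:{0<..}. \<bar>2 * t / ?k\<bar> * ?f (t\<^sup>2 / ?k))"
    unfolding bessel_integral_def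
  proof (rule set_lebesgue_integral_change_of_variables[symmetric])
    show "bij_betw (\<lambda>t. t\<^sup>2 / ?k) {0<..} {0<..}"
      using a by (intro bij_betwI[where g = "\<lambda>w. sqrt (?k * w)"]) (auto simp: field_simps)
    show "((\<lambda>t. t\<^sup>2 / ?k) has_field_derivative 2 * t / ?k) (at t)" if "t \<in> {0<..}" for t
      using a by (auto intro!: derivative_eq_intros simp: field_simps power2_eq_square power4_eq_xxxx)
  qed auto
  then have "?k powr (\<nu> - 1) * bessel_integral \<nu> (q / ?k)
      = (LBINT t:{0<..}. ?k powr (\<nu> - 1) * (\<bar>2 * t / ?k\<bar> * ?f (t\<^sup>2 / ?k)))"
    by simp
  also have "\<dots> = (LBINT t:{0<..}. 2 * t ^ (p - 1) * gamma_density 1 (1 / ?k) (t\<^sup>2)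
            * (t powr (2 * \<nu>) * t powr (- real p) * exp (- q / t\<^sup>2)))"
  proof (intro set_lebesgue_integral_cong ballI allI impI)
    fix t :: real assume "t \<in> {0<..}"
    then have t: "t > 0" by simp
    have "?k powr (\<nu> - 1) * (t\<^sup>2 / ?k) powr (\<nu> - 1) = (t\<^sup>2) powr (\<nu> - 1)"
      using k by (simp add: powr_divide)
    also have "\<dots> = t powr (2 * \<nu> - 2)"
      using t by (simp add: powr_powr algebra_simps flip: powr_numeral)
    finally have 1: "?k powr (\<nu> - 1) * (t\<^sup>2 / ?k) powr (\<nu> - 1) = t powr (2 * \<nu> - 2)" .
    \<comment> \<open>Here \<open>p \<ge> 1\<close> is what makes the truncated subtraction on
      naturals agree with the real one.\<close>
    have "t ^ (p - 1) = t powr (real p - 1)"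
      using t p by (simp flip: powr_realpow add: of_nat_diff)
    then have "t ^ (p - 1) * t powr (2 * \<nu>) * t powr (- real p) = t powr (2 * \<nu> - 1)"
      by (simp flip: powr_add)
    also have "\<dots> = t powr (2 * \<nu> - 2) * t powr 1"
      unfolding powr_add[symmetric] by simp
    finally have 2: "t ^ (p - 1) * t powr (2 * \<nu>) * t powr (- real p) = t powr (2 * \<nu> - 2) * t"
      using t by simp
    have 3: "exp (- (t\<^sup>2 / ?k) - q / ?k / (t\<^sup>2 / ?k)) = exp (- (1 / ?k) * t\<^sup>2) * exp (- q / t\<^sup>2)"
      using a by (simp flip: exp_add)
    have 4: "gamma_density 1 (1 / ?k) (t\<^sup>2) = 1 / ?k * exp (- (1 / ?k) * t\<^sup>2)"
      using a t by (simp add: gamma_density_def)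
    have "?k powr (\<nu> - 1) * (\<bar>2 * t / ?k\<bar> * ?f (t\<^sup>2 / ?k))
        = (?k powr (\<nu> - 1) * (t\<^sup>2 / ?k) powr (\<nu> - 1)) * (2 * t / ?k)
          * exp (- (t\<^sup>2 / ?k) - q / ?k / (t\<^sup>2 / ?k))"
      using t by simp
    also have "\<dots> = 2 / ?k * (t powr (2 * \<nu> - 2) * t) * (exp (- (1 / ?k) * t\<^sup>2) * exp (- q / t\<^sup>2))"
      unfolding 1 3 by simp
    also have "\<dots> = 2 * t ^ (p - 1) * gamma_density 1 (1 / ?k) (t\<^sup>2)
            * (t powr (2 * \<nu>) * t powr (- real p) * exp (- q / t\<^sup>2))"
      unfolding 2[symmetric] 4 by simp
    finally show "?k powr (\<nu> - 1) * (\<bar>2 * t / ?k\<bar> * ?f (t\<^sup>2 / ?k)) = \<dots>" .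
  qed auto
  finally show ?thesis ..
qed

text \<open>The product of the two powers in \<open>g\<close> has exponent
  \<open>\<nu> x + \<nu> y\<close>, twice the mean order, so the mixture integral applies at the
  mean order.\<close>

lemma C_NS_gamma_mixture:
  fixes \<Sigma> :: "real ^ 'n \<Rightarrow> real ^ 'n ^ 'n"
  assumes a: "a > 0"
    and g: "\<And>x t. t > 0 \<Longrightarrow> g x t = c * t powr \<nu> x"
    and M: "M = density lborel (\<lambda>t. ennreal (2 * t ^ (CARD('n) - 1)
              * gamma_density 1 (1 / (4 * a\<^sup>2)) (t\<^sup>2) * indicator {0..} t))"
  shows "C_NS \<Sigma> g M x y = pi powr (- real CARD('n) / 2) * det (Sigma_avg \<Sigma> x y) powr (- 1 / 2)
           * (c\<^sup>2 * ((4 * a\<^sup>2) powr ((\<nu> x + \<nu> y) / 2 - 1)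
              * bessel_integral ((\<nu> x + \<nu> y) / 2) (Q_form \<Sigma> x y (x - y) / (4 * a\<^sup>2))))"
proof -
  let ?p = "CARD('n)"
  let ?q = "Q_form \<Sigma> x y (x - y)"
  let ?\<nu> = "(\<nu> x + \<nu> y) / 2"
  let ?h = "gamma_density 1 (1 / (4 * a\<^sup>2))"
  let ?d = "\<lambda>t. 2 * t ^ (?p - 1) * ?h (t\<^sup>2) * indicator {0..} t :: real"
  let ?F = "\<lambda>t. c\<^sup>2 * (t powr (2 * ?\<nu>) * t powr (- real ?p) * exp (- ?q / t\<^sup>2))"
  have [measurable]: "?h \<in> borel_measurable borel"
    unfolding gamma_density_def by measurable
  \<comment> \<open>Nonnegativity ensures that \<open>ennreal\<close> does not truncate the density
    of \<open>M\<close>.\<close>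
  have h_nonneg: "?h s \<ge> 0" for s
    by (simp add: gamma_density_def)
  have "(LINT t:{0<..}|M. g x t * g y t * t powr (- real ?p) * exp (- ?q / t\<^sup>2))
      = (LINT t:{0<..}|M. ?F t)"
  proof (intro set_lebesgue_integral_cong ballI allI impI)
    fix t :: real assume "t \<in> {0<..}"
    then have t: "t > 0" by simp
    have "2 * ?\<nu> = \<nu> x + \<nu> y"
      by simp
    then have "g x t * g y t = c\<^sup>2 * t powr (2 * ?\<nu>)"
      by (simp only: g[OF t] powr_add power2_eq_square mult.assoc mult.left_commute)
    then show "g x t * g y t * t powr (- real ?p) * exp (- ?q / t\<^sup>2) = ?F t"
      by simp
  qed (simp add: M)
  also have "\<dots> = (LBINT t. ?d t *\<^sub>R (indicator {0<..} t *\<^sub>R ?F t))"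
    unfolding set_lebesgue_integral_def M
    by (rule integral_density) (auto simp: h_nonneg indicator_def)
  also have "\<dots> = (LBINT t:{0<..}. c\<^sup>2 * (2 * t ^ (?p - 1) * ?h (t\<^sup>2)
            * (t powr (2 * ?\<nu>) * t powr (- real ?p) * exp (- ?q / t\<^sup>2))))"
    unfolding set_lebesgue_integral_def
    by (intro Bochner_Integration.integral_cong) (auto simp: indicator_def)
  also have "\<dots> = c\<^sup>2 * ((4 * a\<^sup>2) powr (?\<nu> - 1) * bessel_integral ?\<nu> (?q / (4 * a\<^sup>2)))"
    by (subst set_integral_mult_right, subst gamma_mixture_integral[OF a]) (simp_all add: Suc_leI)
  finally show ?thesis
    by (simp add: C_NS_def)
qed

section \<open>Positive definite matrices and the quadratic form\<close>

lemma sym_pos_def_imp_invertible: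
  assumes "sym_pos_def A"
  shows "invertible A"
proof -
  have "h = 0" if "A *v h = 0" for h
    using assms that unfolding sym_pos_def_def by fastforce
  then show ?thesis
    by (simp add: invertible_left_inverse matrix_left_invertible_ker)
qed

lemma sym_pos_def_Sigma_avg:
  assumes "sym_pos_def (\<Sigma> x)" "sym_pos_def (\<Sigma> y)"
  shows "sym_pos_def (Sigma_avg \<Sigma> x y)"
proof -
  have "transpose (Sigma_avg \<Sigma> x y) = Sigma_avg \<Sigma> x y"
    using assms by (simp add: sym_pos_def_def Sigma_avg_def transpose_def vec_eq_iff)
  moreover have "h \<bullet> (Sigma_avg \<Sigma> x y *v h) = (h \<bullet> (\<Sigma> x *v h) + h \<bullet> (\<Sigma> y *v h)) / 2" for h
    by (simp add: Sigma_avg_def scaleR_matrix_vector_assoc[symmetric]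
        matrix_vector_mult_add_rdistrib inner_add_right)
  ultimately show ?thesis
    using assms unfolding sym_pos_def_def by (metis add_pos_pos half_gt_zero)
qed

text \<open>With A the averaged matrix, the form of the inverse of A at \<open>h\<close> equals the
  form of A at \<open>k\<close>, the solution of \<open>A *v k = h\<close>. This is what lets
  \<open>sqrt\<close> of the form be squared back.\<close>

lemma Q_form_nonneg:
  assumes "sym_pos_def (\<Sigma> x)" "sym_pos_def (\<Sigma> y)"
  shows "Q_form \<Sigma> x y h \<ge> 0"
proof -
  let ?A = "Sigma_avg \<Sigma> x y"
  define k where "k = matrix_inv ?A *v h"
  have A: "sym_pos_def ?A"
    using assms by (rule sym_pos_def_Sigma_avg)
  then have "\<exists>B. ?A ** B = mat 1 \<and> B ** ?A = mat 1"
    using sym_pos_def_imp_invertible invertible_def by blast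
  \<comment> \<open>\<open>matrix_inv\<close> is a Hilbert choice, so invertibility must supply a
    witness first.\<close>
  then have "?A ** matrix_inv ?A = mat 1"
    unfolding matrix_inv_def by (rule someI2_ex) simp
  then have "?A *v k = h"
    by (simp add: k_def matrix_vector_mul_assoc)
  then have "Q_form \<Sigma> x y h = k \<bullet> (?A *v k)"
    by (simp add: Q_form_def k_def inner_commute)
  also have "\<dots> \<ge> 0"
    using A by (cases "k = 0") (auto simp: sym_pos_def_def less_imp_le)
  finally show ?thesis .
qed

section \<open>Normalisation to the correlation\<close>

theorem corollary3p4:
  fixes \<Sigma> :: "real ^ 'n \<Rightarrow> real ^ 'n ^ 'n"
    and \<nu> :: "real ^ 'n \<Rightarrow> real"
    and g :: "real ^ 'n \<Rightarrow> real \<Rightarrow> real"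
    and h :: "real \<Rightarrow> real"
    and M :: "real measure"
    and a c :: real
  assumes "a > 0"
    and "\<And>x. sym_pos_def (\<Sigma> x)"
    and "\<And>x. \<nu> x > 0"
    and "c \<noteq> 0"
    and "\<And>x t. t > 0 \<Longrightarrow> g x t = c * t powr \<nu> x"
    and "h = gamma_density 1 (1 / (4 * a\<^sup>2))"
    and "M = density lborel
           (\<lambda>t. ennreal (2 * t ^ (CARD('n) - 1) * h (t\<^sup>2) * indicator {0..} t))"
  shows "\<forall>x y. correlation (C_NS \<Sigma> g M) x y =
           phi \<Sigma> x y * (2 powr (1 - (\<nu> x + \<nu> y) / 2) / sqrt (Gamma (\<nu> x) * Gamma (\<nu> y)))
           * Matern_M a ((\<nu> x + \<nu> y) / 2) (sqrt (Q_form \<Sigma> x y (x - y)))"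
proof (intro allI)
  fix x y :: "real ^ 'n"
  define K where "K = pi powr (- real CARD('n) / 2) * c\<^sup>2"
  let ?k = "4 * a\<^sup>2"
  let ?q = "Q_form \<Sigma> x y (x - y)"
  let ?\<nu> = "(\<nu> x + \<nu> y) / 2"
  let ?D = "\<lambda>u. det (\<Sigma> u)"
  let ?V = "\<lambda>u. K * (?D u powr (- 1 / 2) * ?k powr (\<nu> u - 1) * Gamma (\<nu> u))"
  note C = C_NS_gamma_mixture[OF assms(1) assms(5) assms(7)[unfolded assms(6)], where \<Sigma> = \<Sigma>]
  have k: "?k > 0" using assms(1) by simp
  \<comment> \<open>\<open>c\<close> may be negative, but only its square enters, so
    \<open>K\<close> comes out of the square root unchanged.\<close>
  have K: "K > 0" using assms(4) by (simp add: K_def)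
  have D: "?D u \<noteq> 0" for u
    using assms(2) sym_pos_def_imp_invertible invertible_det_nz by blast
  have \<nu>: "?\<nu> > 0"
    using assms(3)[of x] assms(3)[of y] by simp
  \<comment> \<open>On the diagonal the lag is 0 and the averaged matrix is
    \<open>\<Sigma> u\<close> itself, so the Bessel integral becomes a Gamma value.\<close>
  have var: "C_NS \<Sigma> g M u u = ?V u" for u
    using assms(3)[of u]
    by (simp add: C K_def Q_form_def Sigma_avg_def bessel_integral_0 flip: scaleR_2)
  have G: "Gamma (\<nu> u) > 0" for u
    using assms(3) by (simp add: Gamma_real_pos)
  have q: "?q \<ge> 0"
    using assms(2) by (intro Q_form_nonneg)
  \<comment> \<open>This selects \<open>z = sqrt ?q / a\<close>, which is the argument at which
    \<open>Matern_M\<close> evaluates \<open>pow_Bessel_K\<close>.\<close>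
  then have "?q / ?k = (sqrt ?q / a)\<^sup>2 / 4"
    by (simp add: power_divide)
  then have cov: "C_NS \<Sigma> g M x y = K * (det (Sigma_avg \<Sigma> x y) powr (- 1 / 2)
      * ?k powr (?\<nu> - 1) * (2 powr (1 - ?\<nu>) * Matern_M a ?\<nu> (sqrt ?q)))"
    using bessel_integral_eq_pow_Bessel_K[OF \<nu>, of "sqrt ?q / a"] assms(1) q
    by (simp only: C K_def Matern_M_def) simp
  \<comment> \<open>The exponents \<open>\<nu> x - 1\<close> and \<open>\<nu> y - 1\<close> average
    to the exponent of \<open>4 * a\<^sup>2\<close> in \<open>cov\<close>, so this power cancels in
    the quotient.\<close>
  have "sqrt (C_NS \<Sigma> g M x x * C_NS \<Sigma> g M y y)
      = K * (?D x powr (- 1 / 4) * ?D y powr (- 1 / 4) * ?k powr (?\<nu> - 1)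
          * sqrt (Gamma (\<nu> x) * Gamma (\<nu> y)))"
  proof (rule real_sqrt_unique)
    have sq: "(z powr r)\<^sup>2 = z powr (2 * r)" for z r :: real
      by (simp add: power2_eq_square flip: powr_add)
    have "?k powr (2 * (?\<nu> - 1)) = ?k powr (\<nu> x - 1) * ?k powr (\<nu> y - 1)"
      by (simp flip: powr_add) (simp add: add_divide_distrib)
    moreover have "(sqrt (Gamma (\<nu> x) * Gamma (\<nu> y)))\<^sup>2 = Gamma (\<nu> x) * Gamma (\<nu> y)"
      using G by (simp add: less_imp_le)
    ultimately show "(K * (?D x powr (- 1 / 4) * ?D y powr (- 1 / 4) * ?k powr (?\<nu> - 1)
          * sqrt (Gamma (\<nu> x) * Gamma (\<nu> y))))\<^sup>2 = C_NS \<Sigma> g M x x * C_NS \<Sigma> g M y y"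
      unfolding var power_mult_distrib sq
      by (simp add: power2_eq_square[of K])
  qed (use G K in \<open>simp add: less_imp_le\<close>)
  then have "correlation (C_NS \<Sigma> g M) x y
      = (K * (det (Sigma_avg \<Sigma> x y) powr (- 1 / 2)
           * ?k powr (?\<nu> - 1) * (2 powr (1 - ?\<nu>) * Matern_M a ?\<nu> (sqrt ?q))))
        / (K * (?D x powr (- 1 / 4) * ?D y powr (- 1 / 4) * ?k powr (?\<nu> - 1)
          * sqrt (Gamma (\<nu> x) * Gamma (\<nu> y))))"
    unfolding correlation_def cov by (rule arg_cong)
  also have "\<dots> = det (Sigma_avg \<Sigma> x y) powr (- 1 / 2) * (2 powr (1 - ?\<nu>) * Matern_M a ?\<nu> (sqrt ?q))
        / (?D x powr (- 1 / 4) * ?D y powr (- 1 / 4) * sqrt (Gamma (\<nu> x) * Gamma (\<nu> y)))"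
    using k K by simp
  \<comment> \<open>Nonzero determinants have nonzero powers, so the powers \<open>- 1 / 4\<close>
    in the denominator become the powers \<open>1 / 4\<close> in \<open>phi\<close>.\<close>
  also have "\<dots> = phi \<Sigma> x y * (2 powr (1 - ?\<nu>) / sqrt (Gamma (\<nu> x) * Gamma (\<nu> y)))
           * Matern_M a ?\<nu> (sqrt ?q)"
    using D[of x] D[of y] by (simp add: phi_def powr_minus field_simps)
  finally show "correlation (C_NS \<Sigma> g M) x y = \<dots>" .
qed

end
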